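(* Let $p$ be an odd prime and let $g,s,\ell$ be positive integers. Let $z=(z_1,\dots,z_{2g+1})$ be variables and let $I^\ell(z,\lambda)=(I_1^\ell,\dots,I_{2g+1}^\ell)$ be the vector of polynomials in $z,\lambda$ with coefficients in $\mathbb Z_p[p^{1/(p-1)}]$ defined as the coefficient of $t^{\ell p^s-1}$ in the power series expansion in $t$ of $$\Psi(t,z,\lambda)=e^{p^{1/(p-1)}\lambda t}\prod_{i=1}^{2g+1}(t-z_i)^{(p^s-1)/2}\left(\frac1{t-z_1},\dots,\frac1{t-z_{2g+1}}\right).$$ (1) If $\lambda\in\mathbb Z_p[p^{1/(p-1)}]$, then $I=I^\ell(z,\lambda)$ is a solution modulo $p^s$ of the KZ equations $$\frac{\partial I_j}{\partial z_i}=\frac12\frac{I_i-I_j}{z_i-z_j}\ (i\neq j),\qquad \frac{\partial I_i}{\partial z_i}=p^{1/(p-1)}\lambda I_i-\frac12\sum_{j\ne i}\frac{I_i-I_j}{z_i-z_j}.$$ (2) If $\lambda\in(\mathbb Z_p[p^{1/(p-1)}])^\times$, then $I=I^\ell(z,\lambda)$ is a solution modulo $p^s$ of the dynamical equations $$\frac{\partial I_i}{\partial\lambda}=p^{1/(p-1)}z_iI_i+\frac1{2\lambda}\sum_{j=1}^{2g+1}I_j,\qquad i=1,\dots,2g+1.$$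
   Context: $\mathbb Z_p$ is the ring of $p$-adic integers and $p^{1/(p-1)}$ is a fixed $(p-1)$-st root of $p$ in an algebraic closure of $\mathbb Q_p$. The exponential is the formal series $e^{p^{1/(p-1)}\lambda t}=\sum_{k\ge0}\frac{p^{k/(p-1)}\lambda^k}{k!}t^k$, whose coefficients are polynomials in $\lambda$ over $\mathbb Z_p[p^{1/(p-1)}]$; the factor $\prod_i(t-z_i)^{(p^s-1)/2}\big/(t-z_j)$ is a polynomial in $t,z$. "Solution modulo $p^s$" for a given value of $\lambda$ means: after taking the derivatives of the polynomials $I^\ell_i(z,\lambda)$ and substituting the given value of $\lambda$, the difference of the two sides of each equation lies in $p^sR$, where $R=\mathbb Z_p[p^{1/(p-1)}][z_1,\dots,z_{2g+1}]\big[(z_i-z_j)^{-1},\ i\ne j\big]$. *)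

theory Defs
  imports
    "Berlekamp_Zassenhaus.Finite_Field"
    "HOL-Algebra.Algebraic_Closure_Type"
    "HOL-Computational_Algebra.Computational_Algebra"
    "HOL-Library.Poly_Mapping"
begin

text \<open>
  With \<open>p = CARD('p)\<close>, \<open>'p padic_int\<close> is the inverse limit of the rings \<open>\<int>/p\<^sup>n\<close>: an element is a sequence of
  residues \<open>x n\<close>, represented in \<open>{0..<p\<^sup>n}\<close>, compatible with reduction.
\<close>

typedef 'p padic_int =
  "{x :: nat \<Rightarrow> int. \<forall>n. x n \<in> {0..<int CARD('p::prime_card) ^ n} \<and>
                         x (Suc n) mod int CARD('p) ^ n = x n}"
proof (intro exI CollectI allI conjI)
  fix n
  show "(\<lambda>_. 0 :: int) n \<in> {0..<int CARD('p) ^ n}"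
    using prime_gt_0_nat[OF prime_card[where 'a = 'p]] by simp
qed simp

setup_lifting type_definition_padic_int

lemma card_prime_gt_1 [simp]: "1 < int CARD('p::prime_card)"
  using prime_gt_1_nat[OF prime_card[where 'a = 'p]] by simp

lemma card_prime_gt_0 [simp]: "0 < int CARD('p::prime_card)"
  using card_prime_gt_1[where 'p = 'p] by linarith

lemma padic_int_coherent:
  fixes f :: "nat \<Rightarrow> int"
  assumes "\<And>n. f (Suc n) mod int CARD('p::prime_card) ^ n = f n mod int CARD('p) ^ n"
  shows "f n mod int CARD('p) ^ n \<in> {0..<int CARD('p) ^ n} \<and>
         f (Suc n) mod int CARD('p) ^ Suc n mod int CARD('p) ^ n = f n mod int CARD('p) ^ n"
proof -
  have "f (Suc n) mod int CARD('p) ^ Suc n mod int CARD('p) ^ n = f (Suc n) mod int CARD('p) ^ n"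
    by (rule mod_mod_cancel) simp
  moreover have "0 < int CARD('p) ^ n" by simp
  ultimately show ?thesis using assms by simp
qed

instantiation padic_int :: (prime_card) comm_ring_1
begin

lift_definition zero_padic_int :: "'a padic_int" is "\<lambda>_. 0" by simp

lift_definition one_padic_int :: "'a padic_int" is "\<lambda>n. 1 mod int CARD('a) ^ n"
  by (intro padic_int_coherent allI) simp

lift_definition plus_padic_int :: "'a padic_int \<Rightarrow> 'a padic_int \<Rightarrow> 'a padic_int"
  is "\<lambda>x y n. (x n + y n) mod int CARD('a) ^ n"
  by (intro padic_int_coherent allI) (metis mod_add_eq)

lift_definition minus_padic_int :: "'a padic_int \<Rightarrow> 'a padic_int \<Rightarrow> 'a padic_int"
  is "\<lambda>x y n. (x n - y n) mod int CARD('a) ^ n"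
  by (intro padic_int_coherent allI) (metis mod_diff_eq)

lift_definition uminus_padic_int :: "'a padic_int \<Rightarrow> 'a padic_int"
  is "\<lambda>x n. (- x n) mod int CARD('a) ^ n"
  by (intro padic_int_coherent allI) (metis mod_minus_eq)

lift_definition times_padic_int :: "'a padic_int \<Rightarrow> 'a padic_int \<Rightarrow> 'a padic_int"
  is "\<lambda>x y n. (x n * y n) mod int CARD('a) ^ n"
  by (intro padic_int_coherent allI) (metis mod_mult_eq)

instance
proof
  fix a b c :: "'a padic_int"
  show "a + b + c = a + (b + c)"
    by transfer (simp add: fun_eq_iff mod_simps algebra_simps)
  show "a + b = b + a"
    by transfer (simp add: fun_eq_iff algebra_simps)
  show "0 + a = a"
    by transfer (simp add: fun_eq_iff)
  show "- a + a = 0"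
    by transfer (simp add: fun_eq_iff mod_simps)
  show "a - b = a + - b"
    by transfer (simp add: fun_eq_iff mod_simps)
  show "a * b * c = a * (b * c)"
    by transfer (simp add: fun_eq_iff mod_simps algebra_simps)
  show "a * b = b * a"
    by transfer (simp add: fun_eq_iff algebra_simps)
  show "1 * a = a"
    by transfer (simp add: fun_eq_iff mod_simps)
  show "(a + b) * c = a * c + b * c"
    by transfer (simp add: fun_eq_iff mod_simps algebra_simps)
  show "(0 :: 'a padic_int) \<noteq> 1"
  proof transfer
    have "(1::int) mod int CARD('a) ^ 1 = 1" by (simp add: mod_pos_pos_trivial)
    then show "(\<lambda>_. 0) \<noteq> (\<lambda>n. 1 mod int CARD('a) ^ n)"
      by (metis zero_neq_one)
  qed
qed

end

lemma Rep_padic_int_mod: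
  fixes x :: "'p::prime_card padic_int"
  assumes "m \<le> n"
  shows "Rep_padic_int x n mod int CARD('p) ^ m = Rep_padic_int x m"
  using assms
proof (induction n rule: dec_induct)
  case base
  then show ?case using Rep_padic_int[of x] by simp
next
  case (step n)
  have "Rep_padic_int x (Suc n) mod int CARD('p) ^ n = Rep_padic_int x n"
    using Rep_padic_int[of x] by simp
  then have "Rep_padic_int x n mod int CARD('p) ^ m
      = Rep_padic_int x (Suc n) mod int CARD('p) ^ n mod int CARD('p) ^ m"
    by simp
  also have "\<dots> = Rep_padic_int x (Suc n) mod int CARD('p) ^ m"
    by (rule mod_mod_cancel) (use step in \<open>simp add: le_imp_power_dvd\<close>)
  finally show ?case using step by simp
qed

lemma Rep_padic_int_of_nat:
  "Rep_padic_int (of_nat k :: 'p::prime_card padic_int) n = int k mod int CARD('p) ^ n"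
proof (induction k)
  case 0
  then show ?case by (simp add: zero_padic_int.rep_eq)
next
  case (Suc k)
  have "Rep_padic_int (of_nat (Suc k) :: 'p padic_int) n
      = (1 mod int CARD('p) ^ n + int k mod int CARD('p) ^ n) mod int CARD('p) ^ n"
    unfolding of_nat_Suc plus_padic_int.rep_eq one_padic_int.rep_eq Suc.IH ..
  then show ?case by (simp only: mod_add_eq of_nat_Suc)
qed

lemma int_less_card_power: "int k < int CARD('p::prime_card) ^ k"
proof -
  have "1 < CARD('p)" using prime_gt_1_nat[OF prime_card[where 'a = 'p]] .
  then have "k < CARD('p) ^ k" using power_gt_expt[of "CARD('p)" k] by simp
  then show ?thesis by (metis of_nat_less_iff of_nat_power)
qed

instance padic_int :: (prime_card) ring_char_0
proof
  show "inj (of_nat :: nat \<Rightarrow> 'a padic_int)"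
  proof (rule injI)
    fix k l assume eq: "of_nat k = (of_nat l :: 'a padic_int)"
    define n where "n = max k l"
    have le: "int CARD('a) ^ m \<le> int CARD('a) ^ n" if "m \<le> n" for m
      using that card_prime_gt_1[where 'p = 'a] by (intro power_increasing) auto
    have "int k mod int CARD('a) ^ n = int l mod int CARD('a) ^ n"
      using eq Rep_padic_int_of_nat[where 'p = 'a] by metis
    moreover have "int k < int CARD('a) ^ n" "int l < int CARD('a) ^ n"
      using int_less_card_power[where 'p = 'a, of k] int_less_card_power[where 'p = 'a, of l]
        le[of k] le[of l] by (auto simp: n_def)
    ultimately show "k = l" by simp
  qed
qed

instance padic_int :: (prime_card) idom
proof
  fix a b :: "'a padic_int"
  assume "a \<noteq> 0" "b \<noteq> 0"
  let ?p = "int CARD('a)"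
  have ex: "\<exists>m. Rep_padic_int x m \<noteq> 0" if "x \<noteq> 0" for x :: "'a padic_int"
    using that by (metis Rep_padic_int_inject ext zero_padic_int.rep_eq)
  obtain m n where mn: "Rep_padic_int a m \<noteq> 0" "Rep_padic_int b n \<noteq> 0"
    using ex \<open>a \<noteq> 0\<close> \<open>b \<noteq> 0\<close> by blast
  define x y where "x = Rep_padic_int a (m + n)" and "y = Rep_padic_int b (m + n)"
  have "\<not> ?p ^ m dvd x" "\<not> ?p ^ n dvd y"
    using mn Rep_padic_int_mod[of m "m + n" a] Rep_padic_int_mod[of n "m + n" b]
    by (auto simp: x_def y_def dvd_eq_mod_eq_0)
  then have nz: "x \<noteq> 0" "y \<noteq> 0" and
    lt: "multiplicity ?p x < m" "multiplicity ?p y < n"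
    using multiplicity_dvd'[of m ?p x] multiplicity_dvd'[of n ?p y] by (auto simp: not_le[symmetric])
  have pr: "Factorial_Ring.prime ?p" using prime_card_int[where 'a = 'a] .
  have "multiplicity ?p (x * y) < m + n"
    using lt nz pr by (subst prime_elem_multiplicity_mult_distrib) auto
  moreover have "x * y \<noteq> 0" "\<not> is_unit ?p" using nz pr by auto
  ultimately have "\<not> ?p ^ (m + n) dvd x * y"
    by (subst power_dvd_iff_le_multiplicity) auto
  then have "Rep_padic_int (a * b) (m + n) \<noteq> 0"
    by (simp add: times_padic_int.rep_eq x_def y_def dvd_eq_mod_eq_0)
  then show "a * b \<noteq> 0" by (auto simp: zero_padic_int.rep_eq)
qed

lemma padic_int_of_nat_unit:
  assumes "coprime m CARD('p::prime_card)"
  shows "\<exists>y :: 'p padic_int. of_nat m * y = 1"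
proof -
  let ?p = "int CARD('p)"
  have cop: "coprime (int m) (?p ^ n)" for n
    using assms by simp
  have "\<exists>y. [int m * y = 1] (mod ?p ^ n)" for n
    using cong_solve_coprime_int[OF cop] by blast
  then obtain f where f: "\<And>n. [int m * f n = 1] (mod ?p ^ n)" by metis
  have coh: "f (Suc n) mod ?p ^ n = f n mod ?p ^ n" for n
  proof -
    have "[int m * f (Suc n) = 1] (mod ?p ^ n)"
      using f[of "Suc n"] by (rule cong_dvd_modulus) (simp add: le_imp_power_dvd)
    then have "[int m * f (Suc n) = int m * f n] (mod ?p ^ n)"
      using f[of n] cong_sym cong_trans by blast
    then show ?thesis using cong_mult_lcancel[OF cop[of n]] unfolding cong_def by blast
  qed
  define y :: "'p padic_int" where "y = Abs_padic_int (\<lambda>n. f n mod ?p ^ n)"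
  have y: "Rep_padic_int y = (\<lambda>n. f n mod ?p ^ n)"
    unfolding y_def using padic_int_coherent[where 'p = 'p, of f] coh
    by (intro Abs_padic_int_inverse) blast
  have "Rep_padic_int (of_nat m * y) = Rep_padic_int (1 :: 'p padic_int)"
    unfolding times_padic_int.rep_eq one_padic_int.rep_eq y Rep_padic_int_of_nat
    using f by (simp only: mod_mult_eq cong_def)
  then show ?thesis using Rep_padic_int_inject by blast
qed

lemma fact_split_prime:
  fixes p k :: nat
  assumes "Factorial_Ring.prime p"
  shows "\<exists>m. coprime m p \<and> fact k = p ^ (k div p) * fact (k div p) * m"
proof (induction k)
  case 0
  then show ?case by (auto intro: exI[of _ 1])
next
  case (Suc k)
  then obtain m where m: "coprime m p" "fact k = p ^ (k div p) * fact (k div p) * m" by blast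
  show ?case
  proof (cases "p dvd Suc k")
    case True
    then have d: "Suc k div p = Suc (k div p)" by (simp add: div_Suc dvd_eq_mod_eq_0)
    have "Suc k = p * Suc (k div p)" using True d by (metis dvd_mult_div_cancel)
    then have "(fact (Suc k) :: nat) = p * Suc (k div p) * fact k"
      by (metis fact_Suc of_nat_id)
    also have "\<dots> = p ^ (Suc k div p) * fact (Suc k div p) * m"
      unfolding m(2) d by (simp add: algebra_simps)
    finally show ?thesis using m(1) by blast
  next
    case False
    then have d: "Suc k div p = k div p" by (simp add: div_Suc dvd_eq_mod_eq_0)
    have "coprime (Suc k) p" using False assms by (simp add: prime_imp_coprime coprime_commute)
    then have "coprime (m * Suc k) p" using m(1) coprime_mult_left_iff by blast
    moreover have "(fact (Suc k) :: nat) = p ^ (Suc k div p) * fact (Suc k div p) * (m * Suc k)"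
      unfolding d fact_Suc m(2) by (simp only: of_nat_id mult_ac)
    ultimately show ?thesis by blast
  qed
qed

instance fract :: ("{idom, ring_char_0}") field_char_0
proof
  have "of_nat n = to_fract (of_nat n :: 'a)" for n
    by (induction n) simp_all
  then show "inj (of_nat :: nat \<Rightarrow> 'a fract)"
    by (auto intro!: injI)
qed

text \<open>\<open>'p padic\<close> is the field \<open>\<rat>\<^sub>p\<close>; \<open>'p padic alg_closure\<close> is its algebraic closure.\<close>

type_synonym 'p padic = "'p padic_int fract"

definition of_padic_int :: "'p::prime_card padic_int \<Rightarrow> 'p padic alg_closure" where
  "of_padic_int x = to_ac (to_fract x)"

inductive_set subring_gen :: "'a::ring_1 set \<Rightarrow> 'a set" for S where
  gen: "x \<in> S \<Longrightarrow> x \<in> subring_gen S"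
| one: "1 \<in> subring_gen S"
| diff: "x \<in> subring_gen S \<Longrightarrow> y \<in> subring_gen S \<Longrightarrow> x - y \<in> subring_gen S"
| mult: "x \<in> subring_gen S \<Longrightarrow> y \<in> subring_gen S \<Longrightarrow> x * y \<in> subring_gen S"

lemma subring_gen_zero [simp]: "0 \<in> subring_gen S"
  using subring_gen.diff[OF subring_gen.one subring_gen.one] by simp

lemma subring_gen_add:
  assumes "x \<in> subring_gen S" "y \<in> subring_gen S"
  shows "x + y \<in> subring_gen S"
  using subring_gen.diff[OF assms(1) subring_gen.diff[OF subring_gen_zero assms(2)]] by simp

lemma subring_gen_sum: "(\<And>i. i \<in> A \<Longrightarrow> f i \<in> subring_gen S) \<Longrightarrow> sum f A \<in> subring_gen S"
  by (induction A rule: infinite_finite_induct) (auto intro: subring_gen_add)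

lemma subring_gen_power: "x \<in> subring_gen S \<Longrightarrow> x ^ n \<in> subring_gen S"
  by (induction n) (auto intro: subring_gen.intros)

definition Zp_adjoin :: "'p::prime_card padic alg_closure \<Rightarrow> 'p padic alg_closure set" where
  "Zp_adjoin \<pi> = subring_gen (range of_padic_int \<union> {\<pi>})"

lemma exp_coeff_integral:
  fixes \<pi> :: "'p::prime_card padic alg_closure"
  assumes "\<pi> ^ (CARD('p) - 1) = of_nat CARD('p)"
  shows "\<pi> ^ k / fact k \<in> Zp_adjoin \<pi>"
proof (induction k rule: less_induct)
  case (less k)
  let ?p = "CARD('p)"
  have p: "Factorial_Ring.prime ?p" by (rule prime_card)
  show ?case
  proof (cases "k = 0")
    case True
    then show ?thesis by (simp add: Zp_adjoin_def subring_gen.one)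
  next
    case False
    define q where "q = k div ?p"
    obtain m where m: "coprime m ?p" "(fact k :: nat) = ?p ^ q * fact q * m"
      using fact_split_prime[OF p] unfolding q_def by blast
    obtain y :: "'p padic_int" where y: "of_nat m * y = 1"
      using padic_int_of_nat_unit[OF m(1)] by blast
    have "of_padic_int (of_nat m * y) = of_nat m * of_padic_int y"
    proof -
      have "to_fract (of_nat m :: 'p padic_int) = of_nat m" by (induction m) simp_all
      then show ?thesis by (simp add: of_padic_int_def)
    qed
    then have my: "of_nat m * of_padic_int y = 1"
      using y by (simp add: of_padic_int_def)
    have "q < k" using False prime_gt_1_nat[OF p] by (simp add: q_def)
    have le: "?p * q \<le> k" by (simp add: q_def)
    have "\<pi> ^ (?p * q) = (\<pi> ^ (?p - 1)) ^ q * \<pi> ^ q"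
      using prime_gt_0_nat[OF p] by (simp flip: power_mult power_add add: algebra_simps)
    then have pq: "\<pi> ^ (?p * q) = of_nat ?p ^ q * \<pi> ^ q"
      using assms by simp
    have "\<pi> ^ k = \<pi> ^ (k - ?p * q) * (of_nat ?p ^ q * \<pi> ^ q)"
      using le by (simp flip: pq power_add)
    moreover have "(fact k :: 'p padic alg_closure) = of_nat ?p ^ q * fact q * of_nat m"
      using arg_cong[OF m(2), of "of_nat :: nat \<Rightarrow> 'p padic alg_closure"] by simp
    moreover have "inverse (of_nat m) = of_padic_int y"
      using my by (simp add: inverse_unique)
    ultimately have "\<pi> ^ k / fact k = \<pi> ^ (k - ?p * q) * of_padic_int y * (\<pi> ^ q / fact q)"
      using prime_gt_0_nat[OF p] by (simp add: divide_inverse mult_ac)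
    moreover have "\<pi> ^ (k - ?p * q) \<in> Zp_adjoin \<pi>" "of_padic_int y \<in> Zp_adjoin \<pi>"
      unfolding Zp_adjoin_def by (auto intro: subring_gen_power subring_gen.gen)
    ultimately show ?thesis
      using less[OF \<open>q < k\<close>] unfolding Zp_adjoin_def by (simp only: subring_gen.mult)
  qed
qed

definition units_of_subring :: "'a::comm_ring_1 set \<Rightarrow> 'a set" where
  "units_of_subring A = {x \<in> A. \<exists>y\<in>A. x * y = 1}"

text \<open>
  Monomials are finitely supported exponent functions, and the variable \<open>z\<^sub>i\<close> is indexed
  by the natural number \<open>i\<close>. Only \<open>z\<^sub>1, \<dots>, z\<^bsub>2g+1\<^esub>\<close> occur below.
\<close>

type_synonym 'a mpoly = "(nat \<Rightarrow>\<^sub>0 nat) \<Rightarrow>\<^sub>0 'a"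

definition mConst :: "'a::zero \<Rightarrow> 'a mpoly" where
  "mConst c = Poly_Mapping.single 0 c"

definition mVar :: "nat \<Rightarrow> 'a::zero_neq_one mpoly" where
  "mVar i = Poly_Mapping.single (Poly_Mapping.single i 1) 1"

definition mDeriv :: "nat \<Rightarrow> 'a::comm_semiring_1 mpoly \<Rightarrow> 'a mpoly" where
  "mDeriv i f = (\<Sum>m\<in>Poly_Mapping.keys f.
     Poly_Mapping.single (m - Poly_Mapping.single i 1)
       (of_nat (Poly_Mapping.lookup m i) * Poly_Mapping.lookup f m))"

text \<open>
  Polynomials in \<open>z\<close> and \<open>\<lambda>\<close> are univariate polynomials in \<open>\<lambda>\<close> over the polynomials
  in \<open>z\<close>; formal power series in \<open>t\<close> are taken over these. The argument \<open>\<pi>\<close> is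
  \<open>p\<^bsup>1/(p-1)\<^esup>\<close>.
\<close>

definition exp_series :: "'a::field_char_0 \<Rightarrow> 'a mpoly poly fps" where
  "exp_series \<pi> = Abs_fps (\<lambda>k. Polynomial.monom (mConst (\<pi> ^ k / fact k)) k)"

definition t_minus_z :: "nat \<Rightarrow> 'a::comm_ring_1 mpoly poly fps" where
  "t_minus_z i = fps_X - fps_const [:mVar i:]"

text \<open>
  The \<open>j\<close>-th coordinate of \<open>\<Psi>\<close>. The factor \<open>1/(t - z\<^sub>j)\<close> lowers the exponent of
  \<open>t - z\<^sub>j\<close> by one; see \<open>Psi_divided\<close> below.
\<close>

definition Psi :: "nat \<Rightarrow> nat \<Rightarrow> nat \<Rightarrow> 'a::field_char_0 \<Rightarrow> nat \<Rightarrow> 'a mpoly poly fps" where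
  "Psi p g s \<pi> j = exp_series \<pi> *
     (\<Prod>i = 1..2 * g + 1. t_minus_z i ^ (if i = j then (p ^ s - 1) div 2 - 1 else (p ^ s - 1) div 2))"

lemma Psi_divided:
  assumes "odd p" "1 < p" "s \<ge> 1" "j \<in> {1..2 * g + 1}"
  shows "t_minus_z j * Psi p g s \<pi> j =
           exp_series \<pi> * (\<Prod>i = 1..2 * g + 1. t_minus_z i ^ ((p ^ s - 1) div 2))"
proof -
  let ?M = "(p ^ s - 1) div 2"
  have "3 \<le> p" using assms(1,2) by (cases "p = 2") auto
  moreover have "p \<le> p ^ s" using assms by (intro self_le_power) auto
  ultimately have M: "?M = Suc (?M - 1)" by linarith
  have "t_minus_z j * (\<Prod>i = 1..2 * g + 1. t_minus_z i ^ (if i = j then ?M - 1 else ?M))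
      = t_minus_z j * (t_minus_z j ^ (?M - 1) *
          (\<Prod>i\<in>{1..2 * g + 1} - {j}. (t_minus_z i :: 'a mpoly poly fps) ^ ?M))"
    using assms(4) by (subst prod.remove[of _ j]) (auto intro!: prod.cong)
  also have "\<dots> = t_minus_z j ^ Suc (?M - 1) *
          (\<Prod>i\<in>{1..2 * g + 1} - {j}. (t_minus_z i :: 'a mpoly poly fps) ^ ?M)"
    by (simp only: power_Suc mult.assoc)
  also have "\<dots> = (\<Prod>i = 1..2 * g + 1. t_minus_z i ^ ?M)"
    using assms(4) M by (subst prod.remove[of _ j]) auto
  finally show ?thesis unfolding Psi_def by (simp only: mult.left_commute)
qed

definition I_poly :: "nat \<Rightarrow> nat \<Rightarrow> nat \<Rightarrow> nat \<Rightarrow> 'a::field_char_0 \<Rightarrow> nat \<Rightarrow> 'a mpoly poly" where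
  "I_poly p g s l \<pi> j = fps_nth (Psi p g s \<pi> j) (l * p ^ s - 1)"

lemma I_poly_integral:
  fixes \<pi> :: "'p::prime_card padic alg_closure"
  assumes "\<pi> ^ (CARD('p) - 1) = of_nat CARD('p)"
  shows "I_poly CARD('p) g s l \<pi> j \<in> subring_gen
     ((\<lambda>c. [:mConst c:]) ` Zp_adjoin \<pi> \<union> (\<lambda>i. [:mVar i:]) ` {1..2 * g + 1} \<union> {[:0, 1:]})"
    (is "_ \<in> subring_gen ?S")
proof -
  define A where "A = {F. \<forall>n. fps_nth F n \<in> subring_gen ?S}"
  have one: "1 \<in> A"
    by (auto simp: A_def subring_gen.one)
  have mult: "F * G \<in> A" if "F \<in> A" "G \<in> A" for F G
    using that by (auto simp: A_def fps_mult_nth intro!: subring_gen_sum subring_gen.mult)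
  have pow: "F ^ n \<in> A" if "F \<in> A" for F n
    using that by (induction n) (auto intro: one mult)
  have prd: "prod f B \<in> A" if "\<And>i. i \<in> B \<Longrightarrow> f i \<in> A" for f and B :: "nat set"
    using that by (induction B rule: infinite_finite_induct) (auto intro: one mult)
  have z: "t_minus_z i \<in> A" if "i \<in> {1..2 * g + 1}" for i
  proof -
    have "[:mVar i:] \<in> subring_gen ?S" using that by (intro subring_gen.gen) blast
    then have "fps_nth (t_minus_z i) n \<in> subring_gen ?S" for n
      unfolding t_minus_z_def fps_sub_nth
      by (intro subring_gen.diff) (auto simp: fps_X_def subring_gen.one)
    then show ?thesis by (simp add: A_def)
  qed
  have e: "exp_series \<pi> \<in> A"
    unfolding A_def
  proof (intro CollectI allI)
    fix n
    have "[:0, 1:] ^ n = Polynomial.monom (1 :: 'p padic alg_closure mpoly) n"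
      by (rule monom_altdef[symmetric, of 1, simplified])
    then have "fps_nth (exp_series \<pi>) n = [:mConst (\<pi> ^ n / fact n):] * [:0, 1:] ^ n"
      by (simp add: exp_series_def smult_monom)
    moreover have "[:mConst (\<pi> ^ n / fact n):] \<in> subring_gen ?S"
      using exp_coeff_integral[OF assms] by (intro subring_gen.gen) blast
    moreover have "[:0, 1:] ^ n \<in> subring_gen ?S"
      by (intro subring_gen_power subring_gen.gen) blast
    ultimately show "fps_nth (exp_series \<pi>) n \<in> subring_gen ?S"
      by (simp only: subring_gen.mult)
  qed
  have "Psi CARD('p) g s \<pi> j \<in> A"
    unfolding Psi_def by (intro mult e prd pow z)
  then show ?thesis by (simp add: A_def I_poly_def)
qed

definition d_dz :: "nat \<Rightarrow> 'a::comm_ring_1 mpoly poly \<Rightarrow> 'a mpoly poly" where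
  "d_dz i f = map_poly (mDeriv i) f"

definition d_dlambda :: "'a::idom mpoly poly \<Rightarrow> 'a mpoly poly" where
  "d_dlambda f = pderiv f"

text \<open>
  The equations are read in the field of fractions of the polynomials in \<open>z\<close>, which contains
  \<open>R = \<int>\<^sub>p[\<pi>][z\<^sub>1, \<dots>, z\<^bsub>2g+1\<^esub>][(z\<^sub>i - z\<^sub>j)\<^bsup>-1\<^esup>, i \<noteq> j]\<close>.
\<close>

abbreviation fConst :: "'a::idom \<Rightarrow> 'a mpoly fract" where
  "fConst c \<equiv> to_fract (mConst c)"

abbreviation fVar :: "nat \<Rightarrow> 'a::idom mpoly fract" where
  "fVar i \<equiv> to_fract (mVar i)"

definition R_ring :: "nat \<Rightarrow> 'p::prime_card padic alg_closure \<Rightarrow> 'p padic alg_closure mpoly fract set" where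
  "R_ring g \<pi> = subring_gen
     (fConst ` Zp_adjoin \<pi> \<union> fVar ` {1..2 * g + 1} \<union>
      {1 / (fVar i - fVar j) |i j. i \<in> {1..2 * g + 1} \<and> j \<in> {1..2 * g + 1} \<and> i \<noteq> j})"

definition cong_R :: "nat \<Rightarrow> nat \<Rightarrow> nat \<Rightarrow> 'p::prime_card padic alg_closure \<Rightarrow>
    'p padic alg_closure mpoly fract \<Rightarrow> 'p padic alg_closure mpoly fract \<Rightarrow> bool" where
  "cong_R p s g \<pi> a b \<longleftrightarrow> (\<exists>r \<in> R_ring g \<pi>. a - b = of_nat (p ^ s) * r)"

definition at_lambda :: "'a::idom \<Rightarrow> 'a mpoly poly \<Rightarrow> 'a mpoly fract" where
  "at_lambda c f = to_fract (poly f (mConst c))"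

definition solves_KZ_mod :: "nat \<Rightarrow> nat \<Rightarrow> nat \<Rightarrow> 'p::prime_card padic alg_closure \<Rightarrow>
    'p padic alg_closure \<Rightarrow> (nat \<Rightarrow> 'p padic alg_closure mpoly poly) \<Rightarrow> bool" where
  "solves_KZ_mod p s g \<pi> lam I \<longleftrightarrow>
     (\<forall>i\<in>{1..2 * g + 1}. \<forall>j\<in>{1..2 * g + 1}. i \<noteq> j \<longrightarrow>
        cong_R p s g \<pi>
          (at_lambda lam (d_dz i (I j)))
          (1 / 2 * ((at_lambda lam (I i) - at_lambda lam (I j)) / (fVar i - fVar j)))) \<and>
     (\<forall>i\<in>{1..2 * g + 1}.
        cong_R p s g \<pi>
          (at_lambda lam (d_dz i (I i)))
          (fConst \<pi> * fConst lam * at_lambda lam (I i)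
           - 1 / 2 * (\<Sum>j\<in>{1..2 * g + 1} - {i}.
                       (at_lambda lam (I i) - at_lambda lam (I j)) / (fVar i - fVar j))))"

definition solves_dynamical_mod :: "nat \<Rightarrow> nat \<Rightarrow> nat \<Rightarrow> 'p::prime_card padic alg_closure \<Rightarrow>
    'p padic alg_closure \<Rightarrow> (nat \<Rightarrow> 'p padic alg_closure mpoly poly) \<Rightarrow> bool" where
  "solves_dynamical_mod p s g \<pi> lam I \<longleftrightarrow>
     (\<forall>i\<in>{1..2 * g + 1}.
        cong_R p s g \<pi>
          (at_lambda lam (d_dlambda (I i)))
          (fConst \<pi> * fVar i * at_lambda lam (I i)
           + 1 / (2 * fConst lam) * (\<Sum>j = 1..2 * g + 1. at_lambda lam (I j))))"

end

theory Submission
  imports Defs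
begin

text \<open>
  Write \<open>\<Phi> = e\<^bsup>\<pi>\<lambda>t\<^esup> \<Prod>\<^sub>i (t - z\<^sub>i)\<^bsup>M\<^esup>\<close> with \<open>M = (p\<^sup>s - 1)/2\<close>, so that \<open>\<Psi>\<^sub>i = \<Phi>/(t - z\<^sub>i)\<close>, and
  \<open>\<Psi>\<^bsub>ij\<^esub> = \<Phi>/((t - z\<^sub>i)(t - z\<^sub>j))\<close>. Then \<open>\<Psi>\<^sub>i - \<Psi>\<^sub>j = (z\<^sub>i - z\<^sub>j) \<Psi>\<^bsub>ij\<^esub>\<close>, and the equations hold
  for the power series in \<open>t\<close> up to \<open>t\<close>-derivatives, with \<open>-M\<close> in place of \<open>1/2\<close>:
  \<open>\<partial>\<^sub>i \<Psi>\<^sub>j = -M \<Psi>\<^bsub>ij\<^esub>\<close>, \<open>\<partial>\<^sub>i \<Psi>\<^sub>i = \<pi>\<lambda> \<Psi>\<^sub>i + M \<Sum>\<^sub>j \<Psi>\<^bsub>ij\<^esub> - \<partial>\<^sub>t \<Psi>\<^sub>i\<close>, and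
  \<open>\<lambda> \<partial>\<^sub>\<lambda> \<Psi>\<^sub>i = \<lambda>\<pi> z\<^sub>i \<Psi>\<^sub>i - M \<Sum>\<^sub>j \<Psi>\<^sub>j + \<partial>\<^sub>t \<Phi>\<close>. Modulo \<open>p\<^sup>s\<close> one has \<open>-M = 1/2\<close>, and the coefficient
  of \<open>t\<^bsup>lp\<^sup>s-1\<^esup>\<close> in a \<open>t\<close>-derivative is divisible by \<open>p\<^sup>s\<close>.
\<close>

section \<open>Derivations\<close>

text \<open>A single product rule serves \<open>mDeriv\<close>, \<open>d_dz\<close>,
  \<open>d_dlambda\<close> and \<open>fps_deriv\<close>, the middle two also when applied to the
  coefficients of a series in t.\<close>

locale derivation =
  fixes D :: "'a::comm_ring_1 \<Rightarrow> 'a"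
  assumes add: "D (x + y) = D x + D y"
    and mult: "D (x * y) = D x * y + x * D y"
begin

lemma zero [simp]: "D 0 = 0"
  using add[of 0 0] by simp

lemma diff: "D (x - y) = D x - D y"
  using add[of "x - y" y] by simp

lemma one [simp]: "D 1 = 0"
  using mult[of 1 1] by simp

lemma sum: "D (sum f A) = (\<Sum>i\<in>A. D (f i))"
  by (induction A rule: infinite_finite_induct) (auto simp: add)

lemma power: "D (x ^ n) = of_nat n * x ^ (n - 1) * D x"
proof (induction n)
  case (Suc n)
  then show ?case
    by (cases n) (simp_all add: mult algebra_simps)
qed simp

text \<open>Lowering one exponent in place keeps the products in the same shape. Truncated
  subtraction is harmless: where \<open>f k = 0\<close>, the factor \<open>of_nat (f k)\<close>
  kills the summand.\<close>

lemma prod_power: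
  assumes "finite A"
  shows "D (\<Prod>i\<in>A. x i ^ f i) =
           (\<Sum>k\<in>A. of_nat (f k) * (\<Prod>i\<in>A. x i ^ (f(k := f k - 1)) i) * D (x k))"
  using assms
proof (induction A rule: finite_induct)
  case (insert a A)
  have a: "(\<Prod>i\<in>A. x i ^ (f(a := f a - 1)) i) = (\<Prod>i\<in>A. x i ^ f i)"
    using insert.hyps by (intro prod.cong) auto
  have k: "(\<Prod>i\<in>insert a A. x i ^ (f(k := f k - 1)) i)
      = x a ^ f a * (\<Prod>i\<in>A. x i ^ (f(k := f k - 1)) i)" if "k \<in> A" for k
    using insert.hyps that by auto
  have "(\<Sum>k\<in>A. of_nat (f k) * (\<Prod>i\<in>insert a A. x i ^ (f(k := f k - 1)) i) * D (x k))
      = x a ^ f a * D (\<Prod>i\<in>A. x i ^ f i)"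
    unfolding insert.IH sum_distrib_left
    by (intro sum.cong refl) (simp only: k mult_ac)
  moreover have "D (x a ^ f a) * (\<Prod>i\<in>A. x i ^ f i)
      = of_nat (f a) * (\<Prod>i\<in>insert a A. x i ^ (f(a := f a - 1)) i) * D (x a)"
    unfolding prod.insert[OF insert.hyps] a power by (simp add: mult_ac)
  ultimately show ?case
    unfolding sum.insert[OF insert.hyps] by (simp add: insert.hyps mult)
qed simp

end

lemma derivation_map_poly:
  assumes "derivation D"
  shows "derivation (map_poly D)"
proof -
  interpret derivation D by fact
  show ?thesis
    by unfold_locales
      (auto intro!: poly_eqI simp: coeff_map_poly coeff_mult add mult sum sum.distrib)
qed

text \<open>Each coefficient of a product of series is a finite sum of products of coefficients, so
  the Leibniz rule passes from coefficients to series.\<close>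

lemma derivation_fps_map:
  assumes "derivation D"
  shows "derivation (\<lambda>F. Abs_fps (\<lambda>n. D (fps_nth F n)))"
proof -
  interpret derivation D by fact
  show ?thesis
    by unfold_locales (auto intro!: fps_ext simp: fps_mult_nth add mult sum sum.distrib)
qed

lemma derivation_fps_deriv: "derivation fps_deriv"
  by unfold_locales (auto simp: algebra_simps)

lemma derivation_d_dlambda: "derivation d_dlambda"
  by unfold_locales (auto simp: d_dlambda_def pderiv_add pderiv_mult)

section \<open>Partial derivatives of multivariate polynomials\<close>

text \<open>Allows \<open>f\<close>, \<open>g\<close> and \<open>f + g\<close> to be differentiated
  over one common index set, although cancellation may shrink the support of the sum.\<close>

lemma mDeriv_superset:
  assumes "finite A" "Poly_Mapping.keys f \<subseteq> A"
  shows "mDeriv i f = (\<Sum>m\<in>A. Poly_Mapping.single (m - Poly_Mapping.single i 1)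
       (of_nat (Poly_Mapping.lookup m i) * Poly_Mapping.lookup f m))"
  unfolding mDeriv_def using assms
  by (intro sum.mono_neutral_left) (auto simp: in_keys_iff)

lemma mDeriv_zero [simp]: "mDeriv i 0 = 0"
  by (simp add: mDeriv_def)

lemma mDeriv_add: "mDeriv i (f + g) = mDeriv i f + mDeriv i g"
proof -
  have *: "finite (Poly_Mapping.keys f \<union> Poly_Mapping.keys g)"
    "Poly_Mapping.keys (f + g) \<subseteq> Poly_Mapping.keys f \<union> Poly_Mapping.keys g"
    by (auto simp: Poly_Mapping.keys_add)
  show ?thesis
    unfolding mDeriv_superset[OF *] mDeriv_superset[OF *(1) Un_upper1]
      mDeriv_superset[OF *(1) Un_upper2]
    by (simp add: lookup_add distrib_left single_add sum.distrib)
qed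

lemma mDeriv_single:
  "mDeriv i (Poly_Mapping.single m c) =
     Poly_Mapping.single (m - Poly_Mapping.single i 1) (of_nat (Poly_Mapping.lookup m i) * c)"
  by (subst mDeriv_superset[of "{m}"]) auto

text \<open>Both sides of the Leibniz rule are additive in each factor, so applying this induction
  to one factor after the other reduces it to monomials.\<close>

lemma poly_mapping_add_induct [case_names zero single add]:
  fixes f :: "'b \<Rightarrow>\<^sub>0 'a::comm_monoid_add"
  assumes "P 0" "\<And>m c. P (Poly_Mapping.single m c)" "\<And>f g. P f \<Longrightarrow> P g \<Longrightarrow> P (f + g)"
  shows "P f"
proof (induction f rule: update_induct)
  case (update f m c)
  have "Poly_Mapping.update m c f = f + Poly_Mapping.single m c"
    using update(1)
    by (intro poly_mapping_eqI) (auto simp: lookup_update lookup_add lookup_single in_keys_iff)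
  then show ?case using update(3) assms(2,3) by simp
qed (rule assms(1))

lemma mDeriv_mult_single:
  "mDeriv i (Poly_Mapping.single m c * Poly_Mapping.single n d) =
     mDeriv i (Poly_Mapping.single m c) * Poly_Mapping.single n d +
     Poly_Mapping.single m c * mDeriv i (Poly_Mapping.single n d)"
proof -
  \<comment> \<open>If z_i does not occur in \<open>m\<close>, truncation can make the two exponents
    differ, but then the coefficient is zero.\<close>
  have shift: "Poly_Mapping.single (m - Poly_Mapping.single i 1 + n) (of_nat (Poly_Mapping.lookup m i) * x)
      = Poly_Mapping.single (m + n - Poly_Mapping.single i 1) (of_nat (Poly_Mapping.lookup m i) * x)"
    for m n :: "nat \<Rightarrow>\<^sub>0 nat" and x :: 'a
  proof (cases "Poly_Mapping.lookup m i = 0")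
    case False
    then have "m - Poly_Mapping.single i 1 + n = m + n - Poly_Mapping.single i 1"
      by (intro poly_mapping_eqI) (auto simp: lookup_add lookup_minus lookup_single when_def)
    then show ?thesis by simp
  qed simp
  show ?thesis
    using shift[of m n "c * d"] shift[of n m "c * d"]
    by (simp add: mDeriv_single mult_single lookup_add distrib_left distrib_right single_add mult_ac add_ac)
qed

lemma derivation_mDeriv: "derivation (mDeriv i)"
proof
  fix f g :: "'a mpoly"
  show "mDeriv i (f * g) = mDeriv i f * g + f * mDeriv i g"
  proof (induction f rule: poly_mapping_add_induct)
    case (single m c)
    show ?case
      by (induction g rule: poly_mapping_add_induct)
        (simp_all add: mDeriv_mult_single mDeriv_add algebra_simps)
  qed (simp_all add: mDeriv_add algebra_simps)
qed (rule mDeriv_add)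

lemma derivation_d_dz: "derivation (d_dz i)"
  using derivation_map_poly[OF derivation_mDeriv] unfolding d_dz_def[abs_def] .

lemma mDeriv_mConst [simp]: "mDeriv i (mConst c) = 0"
  by (simp add: mConst_def mDeriv_single)

lemma mDeriv_mVar: "mDeriv i (mVar j) = (if i = j then 1 else 0)"
  by (simp add: mVar_def mDeriv_single lookup_single when_def)

lemma mConst_mult: "mConst (a * b) = mConst a * mConst b"
  by (simp add: mConst_def mult_single)

lemma mConst_one: "mConst 1 = 1"
  by (simp add: mConst_def)

lemma mConst_of_nat: "mConst (of_nat n) = of_nat n"
  by (induction n) (simp_all add: mConst_def single_add single_one)

section \<open>The master series\<close>

abbreviation fps_dz :: "nat \<Rightarrow> 'a::comm_ring_1 mpoly poly fps \<Rightarrow> 'a mpoly poly fps" where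
  "fps_dz i F \<equiv> Abs_fps (\<lambda>n. d_dz i (fps_nth F n))"

abbreviation fps_dlambda :: "'a::idom mpoly poly fps \<Rightarrow> 'a mpoly poly fps" where
  "fps_dlambda F \<equiv> Abs_fps (\<lambda>n. d_dlambda (fps_nth F n))"

section \<open>Derivatives of the exponential and of the linear factors\<close>

lemma fps_dz_exp_series: "fps_dz i (exp_series \<pi>) = 0"
  by (intro fps_ext poly_eqI) (simp add: exp_series_def d_dz_def coeff_map_poly)

lemma fps_dz_t_minus_z: "fps_dz i (t_minus_z k :: 'a::comm_ring_1 mpoly poly fps) = (if k = i then - 1 else 0)"
proof -
  interpret derivation "d_dz i :: 'a mpoly poly \<Rightarrow> _" by (rule derivation_d_dz)
  have "d_dz i [:mVar k :: 'a mpoly:] = (if k = i then 1 else 0)"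
    by (simp add: d_dz_def Polynomial.map_poly_pCons mDeriv_mVar del: Missing_Polynomial.map_poly_pCons)
  then show ?thesis
    by (cases "k = i") (auto intro!: fps_ext simp: t_minus_z_def diff fps_X_def)
qed

text \<open>The recurrence behind both the t-derivative and the \<open>\<lambda>\<close>-derivative
  of the exponential.\<close>

lemma exp_coeff_Suc:
  fixes \<pi> :: "'a::field_char_0"
  shows "of_nat (Suc n) * mConst (\<pi> ^ Suc n / fact (Suc n)) = mConst \<pi> * mConst (\<pi> ^ n / fact n)"
proof -
  have "of_nat (Suc n) * (\<pi> ^ Suc n / fact (Suc n)) = \<pi> * (\<pi> ^ n / fact n)"
    by (simp add: field_simps del: of_nat_Suc)
  then show ?thesis
    by (metis mConst_mult mConst_of_nat)
qed

lemma fps_deriv_exp_series: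
  "fps_deriv (exp_series \<pi>) = fps_const [:0, mConst \<pi>:] * exp_series \<pi>"
proof (intro fps_ext)
  fix n
  have "of_nat (Suc n) * mConst (\<pi> ^ Suc n / fact (Suc n)) = mConst \<pi> * mConst (\<pi> ^ n / fact n)"
    by (rule exp_coeff_Suc)
  moreover have "of_nat k * Polynomial.monom a m = Polynomial.monom (of_nat k * a) m"
    for k m and a :: "'a mpoly"
    by (simp add: of_nat_poly smult_monom)
  ultimately show "fps_nth (fps_deriv (exp_series \<pi>)) n
      = fps_nth (fps_const [:0, mConst \<pi>:] * exp_series \<pi>) n"
    by (simp add: exp_series_def monom_Suc smult_monom del: of_nat_Suc power_Suc fact_Suc)
qed

lemma fps_deriv_t_minus_z: "fps_deriv (t_minus_z k) = 1"
  by (simp add: t_minus_z_def)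

lemma fps_dlambda_exp_series:
  "fps_dlambda (exp_series \<pi>) = fps_const [:mConst \<pi>:] * fps_X * exp_series \<pi>"
proof (intro fps_ext)
  fix n
  show "fps_nth (fps_dlambda (exp_series \<pi>)) n
      = fps_nth (fps_const [:mConst \<pi>:] * fps_X * exp_series \<pi>) n"
  proof (cases n)
    case 0
    then show ?thesis
      by (simp add: exp_series_def d_dlambda_def pderiv_monom mult.assoc)
  next
    case (Suc m)
    have "of_nat (Suc m) * mConst (\<pi> ^ Suc m / fact (Suc m)) = mConst \<pi> * mConst (\<pi> ^ m / fact m)"
      by (rule exp_coeff_Suc)
    then show ?thesis
      by (simp add: Suc exp_series_def d_dlambda_def pderiv_monom mult.assoc smult_monom
          del: of_nat_Suc power_Suc fact_Suc)
  qed
qed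

lemma fps_dlambda_t_minus_z: "fps_dlambda (t_minus_z k) = 0"
  by (intro fps_ext) (simp add: t_minus_z_def d_dlambda_def pderiv_diff fps_X_def pderiv_pCons)

text \<open>A free exponent function covers all series at once: constantly M it gives
  \<open>\<Phi>\<close>, lowered by one at i it gives \<open>\<Psi>\<^sub>i\<close>, lowered at i
  and j it gives \<open>\<Psi>\<^sub>i\<^sub>j\<close>.\<close>

definition master :: "nat \<Rightarrow> 'a::field_char_0 \<Rightarrow> (nat \<Rightarrow> nat) \<Rightarrow> 'a mpoly poly fps" where
  "master g \<pi> f = exp_series \<pi> * (\<Prod>i = 1..2 * g + 1. t_minus_z i ^ f i)"

lemma derivation_master:
  assumes "derivation D"
  shows "D (master g \<pi> f) = D (exp_series \<pi>) * (\<Prod>i = 1..2 * g + 1. t_minus_z i ^ f i) +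
     (\<Sum>k = 1..2 * g + 1. of_nat (f k) * master g \<pi> (f(k := f k - 1)) * D (t_minus_z k))"
proof -
  interpret derivation D by fact
  show ?thesis
    unfolding master_def mult prod_power[OF finite_atLeastAtMost] sum_distrib_left
    by (simp only: mult_ac)
qed

text \<open>Replaces division by t - z_k: relations between \<open>\<Phi>\<close>,
  \<open>\<Psi>\<^sub>i\<close> and \<open>\<Psi>\<^sub>i\<^sub>j\<close> are obtained by raising
  exponents.\<close>

lemma t_minus_z_mult_master:
  fixes \<pi> :: "'a::field_char_0"
  assumes "k \<in> {1..2 * g + 1}"
  shows "t_minus_z k * master g \<pi> f = master g \<pi> (f(k := Suc (f k)))"
proof -
  have "t_minus_z k * (\<Prod>i = 1..2 * g + 1. t_minus_z i ^ f i)
      = t_minus_z k ^ Suc (f k) * (\<Prod>i\<in>{1..2 * g + 1} - {k}. t_minus_z i ^ f i :: 'a mpoly poly fps)"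
    by (simp only: prod.remove[OF finite_atLeastAtMost assms] power_Suc mult.assoc)
  also have "(\<Prod>i\<in>{1..2 * g + 1} - {k}. t_minus_z i ^ f i :: 'a mpoly poly fps)
      = (\<Prod>i\<in>{1..2 * g + 1} - {k}. t_minus_z i ^ (f(k := Suc (f k))) i)"
    by (intro prod.cong) auto
  also have "t_minus_z k ^ Suc (f k) * \<dots> = (\<Prod>i = 1..2 * g + 1. t_minus_z i ^ (f(k := Suc (f k))) i)"
    by (simp only: prod.remove[OF finite_atLeastAtMost assms] fun_upd_same)
  finally show ?thesis
    unfolding master_def by (simp only: mult.left_commute)
qed

lemma fps_dz_master:
  assumes "i \<in> {1..2 * g + 1}"
  shows "fps_dz i (master g \<pi> f) = - (of_nat (f i) * master g \<pi> (f(i := f i - 1)))"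
  unfolding derivation_master[OF derivation_fps_map[OF derivation_d_dz]]
    fps_dz_exp_series fps_dz_t_minus_z
  using assms by (simp add: if_distrib[of "\<lambda>x. _ * x"] sum.delta cong: if_cong)

lemma fps_deriv_master:
  "fps_deriv (master g \<pi> f) = fps_const [:0, mConst \<pi>:] * master g \<pi> f +
     (\<Sum>k = 1..2 * g + 1. of_nat (f k) * master g \<pi> (f(k := f k - 1)))"
  unfolding derivation_master[OF derivation_fps_deriv] fps_deriv_exp_series fps_deriv_t_minus_z
  by (simp add: master_def mult_ac)

lemma fps_dlambda_master:
  "fps_dlambda (master g \<pi> f) = fps_const [:mConst \<pi>:] * fps_X * master g \<pi> f"
  unfolding derivation_master[OF derivation_fps_map[OF derivation_d_dlambda]]
    fps_dlambda_exp_series fps_dlambda_t_minus_z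
  by (simp add: master_def mult_ac)

lemma Psi_eq_master: "Psi p g s \<pi> j = master g \<pi> ((\<lambda>_. (p ^ s - 1) div 2)(j := (p ^ s - 1) div 2 - 1))"
  unfolding Psi_def master_def by (intro arg_cong2[of _ _ _ _ "(*)"] refl prod.cong) simp

section \<open>Integrality\<close>

lemma to_fract_power: "to_fract (x ^ n) = to_fract x ^ n"
  by (induction n) simp_all

lemma at_lambda_simps [simp]:
  "at_lambda c 0 = 0" "at_lambda c 1 = 1"
  "at_lambda c (f + h) = at_lambda c f + at_lambda c h"
  "at_lambda c (f - h) = at_lambda c f - at_lambda c h"
  "at_lambda c (- f) = - at_lambda c f"
  "at_lambda c (f * h) = at_lambda c f * at_lambda c h"
  "at_lambda c [:a:] = to_fract a"
  "at_lambda c [:0, a:] = to_fract (mConst c) * to_fract a"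
  by (simp_all add: at_lambda_def)

lemma at_lambda_of_nat [simp]: "at_lambda c (of_nat n) = of_nat n"
  by (induction n) simp_all

lemma at_lambda_sum: "at_lambda c (sum f A) = (\<Sum>i\<in>A. at_lambda c (f i))"
  by (induction A rule: infinite_finite_induct) simp_all

lemma subring_gen_uminus: "x \<in> subring_gen S \<Longrightarrow> - x \<in> subring_gen S"
  using subring_gen.diff[OF subring_gen_zero] by fastforce

lemma subring_gen_of_nat: "of_nat n \<in> subring_gen S"
  by (induction n) (auto intro: subring_gen_add subring_gen.one)

lemma fConst_in_R_ring: "c \<in> Zp_adjoin \<pi> \<Longrightarrow> fConst c \<in> R_ring g \<pi>"
  unfolding R_ring_def by (intro subring_gen.gen) blast

lemma master_integral:
  fixes \<pi> :: "'p::prime_card padic alg_closure"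
  assumes "\<pi> ^ (CARD('p) - 1) = of_nat CARD('p)" and "lam \<in> Zp_adjoin \<pi>"
  shows "at_lambda lam (fps_nth (master g \<pi> f) n) \<in> R_ring g \<pi>"
proof -
  \<comment> \<open>This set is closed under products, so only the factors need checking;
    \<open>exp_coeff_integral\<close> handles the denominators k! of the exponential.\<close>
  define A where "A = {F. \<forall>n. at_lambda lam (fps_nth F n) \<in> R_ring g \<pi>}"
  have one: "1 \<in> A"
    by (auto simp: A_def R_ring_def subring_gen.one)
  have mult: "F * G \<in> A" if "F \<in> A" "G \<in> A" for F G
    using that by (auto simp: A_def R_ring_def fps_mult_nth at_lambda_sum
        intro!: subring_gen_sum subring_gen.mult)
  have pow: "F ^ n \<in> A" if "F \<in> A" for F n
    using that by (induction n) (auto intro: one mult)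
  have prd: "prod h B \<in> A" if "\<And>i. i \<in> B \<Longrightarrow> h i \<in> A" for h and B :: "nat set"
    using that by (induction B rule: infinite_finite_induct) (auto intro: one mult)
  have z: "t_minus_z i \<in> A" if "i \<in> {1..2 * g + 1}" for i
  proof -
    have "fVar i \<in> R_ring g \<pi>"
      unfolding R_ring_def using that by (intro subring_gen.gen) blast
    then show ?thesis
      by (auto simp: A_def t_minus_z_def R_ring_def fps_X_def
          intro!: subring_gen.diff subring_gen.one subring_gen_uminus)
  qed
  have "at_lambda lam (fps_nth (exp_series \<pi>) k) = fConst (\<pi> ^ k / fact k) * fConst lam ^ k" for k
    by (simp add: exp_series_def at_lambda_def poly_monom to_fract_power)
  then have e: "exp_series \<pi> \<in> A"
    using fConst_in_R_ring[OF exp_coeff_integral[OF assms(1)], where g = g]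
      fConst_in_R_ring[OF assms(2), where g = g]
    by (auto simp: A_def R_ring_def intro!: subring_gen.mult subring_gen_power)
  have "master g \<pi> f \<in> A"
    unfolding master_def by (intro mult e prd pow z)
  then show ?thesis by (simp add: A_def)
qed

text \<open>For odd p the number 2 is a unit of the p-adic integers; its inverse is carried along
  the embeddings into the fraction field.\<close>

lemma half_in_R_ring:
  fixes \<pi> :: "'p::prime_card padic alg_closure"
  assumes "odd CARD('p)"
  shows "\<exists>h \<in> R_ring g \<pi>. 2 * h = 1"
proof -
  obtain y :: "'p padic_int" where y: "of_nat 2 * y = 1"
    using padic_int_of_nat_unit[where 'p = 'p, of 2] assms coprime_left_2_iff_odd by blast
  have "y + y = 1" using y by (simp only: of_nat_numeral mult_2)
  then have "to_ac (to_fract (y + y)) = 1" by (simp only: to_fract_1 to_ac_1)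
  then have "of_padic_int y + of_padic_int y = 1"
    unfolding of_padic_int_def by (simp only: to_fract_add to_ac_add)
  then have "mConst (of_padic_int y) + mConst (of_padic_int y) = 1"
    unfolding mConst_def single_add[symmetric] by simp
  then have "2 * fConst (of_padic_int y) = 1"
    unfolding mult_2 to_fract_add[symmetric] by (simp only: to_fract_1)
  moreover have "fConst (of_padic_int y) \<in> R_ring g \<pi>"
    unfolding Zp_adjoin_def by (intro fConst_in_R_ring) (auto simp: Zp_adjoin_def intro: subring_gen.gen)
  ultimately show ?thesis by blast
qed

section \<open>Congruences between coefficients\<close>

lemma fps_nth_of_nat_mult: "fps_nth (of_nat k * F) n = of_nat k * fps_nth F n"
  for F :: "'a::comm_ring_1 fps"
  by (simp flip: fps_of_nat)

text \<open>The derivative in z_i tells the variables apart. This makes z_i - z_j nonzero for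
  distinct indices, so that it can be divided by.\<close>

lemma mVar_eq_iff: "mVar i = (mVar j :: 'a::comm_ring_1 mpoly) \<longleftrightarrow> i = j"
proof
  assume "mVar i = (mVar j :: 'a mpoly)"
  then have "mDeriv i (mVar j :: 'a mpoly) = mDeriv i (mVar i)" by simp
  then show "i = j" by (simp add: mDeriv_mVar split: if_splits)
qed simp

section \<open>The coefficient of \<open>t ^ (l * p ^ s - 1)\<close> at a fixed value of
  \<open>\<lambda>\<close>\<close>

context
  fixes p g s l M :: nat and \<pi> lam :: "'p::prime_card padic alg_closure"
  assumes p: "p = CARD('p)" "odd p" and s: "s \<ge> 1" and l: "l \<ge> 1"
    and pi: "\<pi> ^ (p - 1) = of_nat p" and lam: "lam \<in> Zp_adjoin \<pi>"
    and M: "M = (p ^ s - 1) div 2"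
begin

private definition c :: "'p padic alg_closure mpoly poly fps \<Rightarrow> 'p padic alg_closure mpoly fract" where
  "c F = at_lambda lam (fps_nth F (l * p ^ s - 1))"

private definition a :: "nat \<Rightarrow> 'p padic alg_closure mpoly fract" where
  "a i = at_lambda lam (I_poly p g s l \<pi> i)"

text \<open>For distinct indices, the coefficient of \<open>\<Psi>\<^sub>i\<^sub>j\<close>: the
  quotient of \<open>a i - a j\<close> by z_i - z_j in a form without denominators.\<close>

private definition Q :: "nat \<Rightarrow> nat \<Rightarrow> 'p padic alg_closure mpoly fract" where
  "Q i j = c (master g \<pi> ((\<lambda>_. M)(i := M - 1, j := M - 1)))"

private lemma c_simps:
  "c (F + G) = c F + c G" "c (F - G) = c F - c G" "c (- F) = - c F"
  "c (of_nat k * F) = of_nat k * c F" "c (fps_const x * F) = at_lambda lam x * c F"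
  "c (sum h A) = (\<Sum>i\<in>A. c (h i))"
  by (simp_all add: c_def fps_nth_of_nat_mult fps_sum_nth at_lambda_sum)

text \<open>\<open>M \<ge> 1\<close> makes lowering the exponent M genuine;
  \<open>p ^ s = 2 * M + 1\<close> is the source of -M = 1/2 modulo \<open>p ^ s\<close>.\<close>

private lemma M_pos: "M \<ge> 1" and p_power: "p ^ s = 2 * M + 1"
proof -
  have "p \<ge> 2" using prime_ge_2_nat[OF prime_card[where 'a = 'p]] p by simp
  then have "p \<ge> 3" using p(2) by (cases "p = 2") auto
  moreover have "p \<le> p ^ s" using s \<open>p \<ge> 2\<close> by (intro self_le_power) auto
  ultimately have "p ^ s \<ge> 3" by linarith
  moreover have "odd (p ^ s)" using p(2) by simp
  ultimately show "M \<ge> 1" "p ^ s = 2 * M + 1" unfolding M by presburger+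
qed

private lemma c_fps_deriv: "\<exists>r \<in> R_ring g \<pi>. c (fps_deriv (master g \<pi> f)) = of_nat (p ^ s) * r"
proof -
  \<comment> \<open>The t-derivative takes its coefficient from one degree higher, with factor
    \<open>l * p ^ s\<close>; positivity of \<open>l\<close> keeps the subtraction from
    truncating.\<close>
  have N: "l * p ^ s - 1 + 1 = l * p ^ s"
    using l p_power by simp
  let ?x = "at_lambda lam (fps_nth (master g \<pi> f) (l * p ^ s))"
  have "c (fps_deriv (master g \<pi> f)) = of_nat (l * p ^ s) * ?x"
    unfolding c_def fps_deriv_nth N at_lambda_simps at_lambda_of_nat ..
  then have "c (fps_deriv (master g \<pi> f)) = of_nat (p ^ s) * (of_nat l * ?x)"
    by (simp only: of_nat_mult mult_ac)
  moreover have "of_nat l * ?x \<in> R_ring g \<pi>"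
    using master_integral[of \<pi> lam g f] pi lam p(1)
    unfolding R_ring_def by (intro subring_gen.mult subring_gen_of_nat) blast
  ultimately show ?thesis by blast
qed

private lemma a_eq: "a i = c (master g \<pi> ((\<lambda>_. M)(i := M - 1)))"
  by (simp add: a_def c_def I_poly_def Psi_eq_master M)

private lemma a_in: "a i \<in> R_ring g \<pi>" and Q_in: "Q i j \<in> R_ring g \<pi>"
  unfolding a_eq Q_def c_def using master_integral[of \<pi> lam] pi lam p(1) by auto

text \<open>Both series are multiples of \<open>\<Psi>\<^sub>i\<^sub>j\<close>, and (t - z_j) - (t -
  z_i) = z_i - z_j is free of t, so it comes out of the coefficient.\<close>

private lemma Q_quotient:
  assumes "i \<in> {1..2 * g + 1}" "j \<in> {1..2 * g + 1}" "i \<noteq> j"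
  shows "(a i - a j) / (fVar i - fVar j) = Q i j"
proof -
  let ?f = "(\<lambda>_. M)(i := M - 1, j := M - 1)"
  have upd: "?f(i := Suc (?f i)) = (\<lambda>_. M)(j := M - 1)" "?f(j := Suc (?f j)) = (\<lambda>_. M)(i := M - 1)"
    using assms(3) M_pos by (auto simp: fun_eq_iff)
  have "master g \<pi> ((\<lambda>_. M)(i := M - 1)) - master g \<pi> ((\<lambda>_. M)(j := M - 1))
      = (t_minus_z j - t_minus_z i) * master g \<pi> ?f"
    unfolding left_diff_distrib t_minus_z_mult_master[OF assms(1)]
      t_minus_z_mult_master[OF assms(2)] upd ..
  also have "t_minus_z j - t_minus_z i = fps_const [:mVar i - mVar j :: 'p padic alg_closure mpoly:]"
    by (simp add: t_minus_z_def)
  finally have "a i - a j = to_fract (mVar i - mVar j) * Q i j"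
    unfolding a_eq Q_def by (metis c_simps(2,5) at_lambda_simps(7))
  moreover have "to_fract (mVar i - mVar j) = (fVar i - fVar j :: 'p padic alg_closure mpoly fract)"
    by simp
  moreover have "(fVar i :: 'p padic alg_closure mpoly fract) \<noteq> fVar j"
    using assms(3) by (simp add: mVar_eq_iff)
  ultimately show ?thesis by (simp add: field_simps)
qed

private lemma half: obtains h where "h \<in> R_ring g \<pi>" "2 * h = 1" "1 / 2 = h"
proof -
  obtain h where h: "h \<in> R_ring g \<pi>" "2 * h = 1"
    using half_in_R_ring p by blast
  moreover from h have "1 / 2 = h" by (simp only: divide_inverse inverse_unique mult_1_left)
  ultimately show thesis using that by blast
qed

private lemma of_nat_M: "of_nat (p ^ s) = 2 * of_nat M + (1 :: 'p padic alg_closure mpoly fract)"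
  by (simp add: p_power)

lemma solves_KZ_mod_I_poly: "solves_KZ_mod p s g \<pi> lam (I_poly p g s l \<pi>)"
  unfolding solves_KZ_mod_def a_def[symmetric]
proof (intro conjI ballI impI)
  obtain h where h: "h \<in> R_ring g \<pi>" "2 * h = 1" "1 / 2 = h" by (rule half)
  fix i assume i: "i \<in> {1..2 * g + 1}"
  {
    fix j assume j: "j \<in> {1..2 * g + 1}" "i \<noteq> j"
    have "at_lambda lam (d_dz i (I_poly p g s l \<pi> j)) = c (fps_dz i (master g \<pi> ((\<lambda>_. M)(j := M - 1))))"
      by (simp add: c_def I_poly_def Psi_eq_master M)
    also have "\<dots> = - (of_nat M * Q i j)"
      unfolding fps_dz_master[OF i] c_simps Q_def using j(2) by (simp add: fun_upd_twist)
    \<comment> \<open>The factor \<open>2 * h = 1\<close> is inserted so that 2M h + h becomes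
      \<open>p ^ s * h\<close>.\<close>
    finally have "at_lambda lam (d_dz i (I_poly p g s l \<pi> j))
        - 1 / 2 * ((a i - a j) / (fVar i - fVar j)) = - (of_nat M * (2 * h) * Q i j) - h * Q i j"
      unfolding Q_quotient[OF i j] h(2) h(3) by simp
    also have "\<dots> = of_nat (p ^ s) * - (h * Q i j)"
      unfolding of_nat_M by (simp add: algebra_simps)
    finally show "cong_R p s g \<pi> (at_lambda lam (d_dz i (I_poly p g s l \<pi> j)))
        (1 / 2 * ((a i - a j) / (fVar i - fVar j)))"
      unfolding cong_R_def using h(1) Q_in[of i j]
      by (auto simp: R_ring_def intro!: bexI[of _ "- (h * Q i j)"] subring_gen_uminus subring_gen.mult)
  }
  \<comment> \<open>The diagonal equation: here z_i-differentiation lowers the exponent at i a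
    second time, and this term is eliminated through the t-derivative of
    \<open>\<Psi>\<^sub>i\<close>.\<close>
  let ?f = "(\<lambda>_. M)(i := M - 1)"
  let ?S = "\<Sum>j\<in>{1..2 * g + 1} - {i}. Q i j"
  have S: "(\<Sum>j\<in>{1..2 * g + 1} - {i}. (a i - a j) / (fVar i - fVar j)) = ?S"
    using Q_quotient[OF i] by (intro sum.cong) auto
  obtain r where r: "r \<in> R_ring g \<pi>" "c (fps_deriv (master g \<pi> ?f)) = of_nat (p ^ s) * r"
    using c_fps_deriv by blast
  have S': "(\<Sum>k\<in>{1..2 * g + 1} - {i}. of_nat (?f k) * c (master g \<pi> (?f(k := ?f k - 1)))) = of_nat M * ?S"
    unfolding sum_distrib_left by (intro sum.cong refl) (auto simp: Q_def)
  \<comment> \<open>If M = 1, the exponent \<open>M - 1 - 1\<close> truncates, but its term carries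
    the factor \<open>M - 1 = 0\<close>.\<close>
  have "c (fps_deriv (master g \<pi> ?f)) = fConst \<pi> * fConst lam * a i
      + of_nat (M - 1) * c (master g \<pi> (?f(i := M - 1 - 1))) + of_nat M * ?S"
    unfolding fps_deriv_master c_simps sum.remove[OF finite_atLeastAtMost i] S'
    by (simp add: a_eq add_ac)
  moreover have "at_lambda lam (d_dz i (I_poly p g s l \<pi> i)) = c (fps_dz i (master g \<pi> ?f))"
    by (simp add: c_def I_poly_def Psi_eq_master M)
  moreover have "\<dots> = - (of_nat (M - 1) * c (master g \<pi> (?f(i := M - 1 - 1))))"
    unfolding fps_dz_master[OF i] c_simps by simp
  ultimately have "at_lambda lam (d_dz i (I_poly p g s l \<pi> i))
      = fConst \<pi> * fConst lam * a i + of_nat M * ?S - of_nat (p ^ s) * r"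
    unfolding r(2) by (simp only: algebra_simps) simp
  then have "at_lambda lam (d_dz i (I_poly p g s l \<pi> i)) - (fConst \<pi> * fConst lam * a i - 1 / 2 * ?S)
      = of_nat M * (2 * h) * ?S + h * ?S - of_nat (p ^ s) * r"
    unfolding h(2) h(3) by (simp add: algebra_simps)
  also have "\<dots> = of_nat (p ^ s) * (h * ?S - r)"
    unfolding of_nat_M by (simp add: algebra_simps)
  finally show "cong_R p s g \<pi> (at_lambda lam (d_dz i (I_poly p g s l \<pi> i)))
      (fConst \<pi> * fConst lam * a i - 1 / 2 *
        (\<Sum>j\<in>{1..2 * g + 1} - {i}. (a i - a j) / (fVar i - fVar j)))"
    unfolding cong_R_def S using h(1) Q_in r(1)
    by (intro bexI[of _ "h * ?S - r"])
      (auto simp: R_ring_def intro!: subring_gen.diff subring_gen.mult subring_gen_sum)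
qed

lemma solves_dynamical_mod_I_poly:
  assumes "lam \<in> units_of_subring (Zp_adjoin \<pi>)"
  shows "solves_dynamical_mod p s g \<pi> lam (I_poly p g s l \<pi>)"
  unfolding solves_dynamical_mod_def a_def[symmetric]
proof
  obtain h where h: "h \<in> R_ring g \<pi>" "2 * h = 1" "1 / 2 = h" by (rule half)
  obtain y where y: "y \<in> Zp_adjoin \<pi>" "lam * y = 1"
    using assms by (auto simp: units_of_subring_def)
  have u: "fConst lam * fConst y = 1"
    using y(2) by (metis mConst_mult mConst_one to_fract_1 to_fract_mult)
  fix i assume i: "i \<in> {1..2 * g + 1}"
  let ?f = "(\<lambda>_. M)(i := M - 1)" and ?S = "\<Sum>j = 1..2 * g + 1. a j"
  let ?F = "c (master g \<pi> (\<lambda>_. M))"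
  obtain r where r: "r \<in> R_ring g \<pi>" "c (fps_deriv (master g \<pi> (\<lambda>_. M))) = of_nat (p ^ s) * r"
    using c_fps_deriv by blast
  have "c (fps_deriv (master g \<pi> (\<lambda>_. M))) = fConst lam * fConst \<pi> * ?F + of_nat M * ?S"
    unfolding fps_deriv_master c_simps by (simp add: a_eq sum_distrib_left distrib_left)
  then have F: "fConst lam * (fConst \<pi> * ?F) = of_nat (p ^ s) * r - of_nat M * ?S"
    unfolding r(2) by (simp add: algebra_simps)
  \<comment> \<open>The t-derivative of \<open>\<Phi>\<close> controls only \<open>lam\<close> times
    this term; the inverse \<open>y\<close> of \<open>lam\<close> cancels that factor without
    leaving R.\<close>
  have "fConst \<pi> * ?F = fConst lam * fConst y * (fConst \<pi> * ?F)"
    unfolding u by simp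
  also have "\<dots> = fConst y * (of_nat (p ^ s) * r - of_nat M * ?S)"
    unfolding F[symmetric] by (simp only: mult_ac)
  finally have F': "fConst \<pi> * ?F = fConst y * (of_nat (p ^ s) * r - of_nat M * ?S)" .
  have upd: "?f(i := Suc (?f i)) = (\<lambda>_. M)"
    using M_pos by (auto simp: fun_eq_iff)
  \<comment> \<open>The \<open>\<lambda>\<close>-derivative brings down \<open>\<pi>\<close> t;
    writing t = z_i + (t - z_i) splits it into the z_i term of the equation and a multiple of
    \<open>\<Phi>\<close>.\<close>
  have "fps_X * master g \<pi> ?f = fps_const [:mVar i:] * master g \<pi> ?f + master g \<pi> (\<lambda>_. M)"
    using t_minus_z_mult_master[OF i, of \<pi> ?f] unfolding upd t_minus_z_def
    by (simp add: algebra_simps)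
  then have "fps_dlambda (master g \<pi> ?f) = fps_const [:mConst \<pi>:] *
      (fps_const [:mVar i:] * master g \<pi> ?f + master g \<pi> (\<lambda>_. M))"
    unfolding fps_dlambda_master by (simp only: mult.assoc)
  then have "c (fps_dlambda (master g \<pi> ?f)) = fConst \<pi> * (fVar i * a i + ?F)"
    by (simp only: c_simps a_eq at_lambda_simps)
  moreover have "at_lambda lam (d_dlambda (I_poly p g s l \<pi> i)) = c (fps_dlambda (master g \<pi> ?f))"
    by (simp add: c_def I_poly_def Psi_eq_master M)
  ultimately have "at_lambda lam (d_dlambda (I_poly p g s l \<pi> i))
      = fConst \<pi> * fVar i * a i + fConst \<pi> * ?F"
    by (simp only: distrib_left mult.assoc)
  moreover have "1 / (2 * fConst lam) = h * fConst y"
  proof -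
    have "2 * fConst lam * (h * fConst y) = (2 * h) * (fConst lam * fConst y)"
      by (simp only: mult_ac)
    then have "2 * fConst lam * (h * fConst y) = 1" unfolding h(2) u by simp
    then show ?thesis by (simp only: divide_inverse inverse_unique mult_1_left)
  qed
  ultimately have "at_lambda lam (d_dlambda (I_poly p g s l \<pi> i))
      - (fConst \<pi> * fVar i * a i + 1 / (2 * fConst lam) * ?S)
      = fConst y * (of_nat (p ^ s) * r - of_nat M * (2 * h) * ?S) - h * fConst y * ?S"
    unfolding F' h(2) by simp
  also have "\<dots> = of_nat (p ^ s) * (fConst y * (r - h * ?S))"
    unfolding of_nat_M by (simp add: algebra_simps)
  finally show "cong_R p s g \<pi> (at_lambda lam (d_dlambda (I_poly p g s l \<pi> i)))
      (fConst \<pi> * fVar i * a i + 1 / (2 * fConst lam) * ?S)"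
    unfolding cong_R_def using h(1) a_in r(1) fConst_in_R_ring[OF y(1), where g = g]
    by (intro bexI[of _ "fConst y * (r - h * ?S)"])
      (auto simp: R_ring_def intro!: subring_gen.diff subring_gen.mult subring_gen_add subring_gen_sum)
qed

end

theorem theorem1p9:
  fixes p g s l :: nat
    and \<pi> :: "'p::prime_card padic alg_closure"
  assumes "p = CARD('p)" and "odd p"
    and "g \<ge> 1" and "s \<ge> 1" and "l \<ge> 1"
    and "\<pi> ^ (p - 1) = of_nat p"
  shows "(\<forall>lam \<in> Zp_adjoin \<pi>. solves_KZ_mod p s g \<pi> lam (I_poly p g s l \<pi>)) \<and>
         (\<forall>lam \<in> units_of_subring (Zp_adjoin \<pi>).
            solves_dynamical_mod p s g \<pi> lam (I_poly p g s l \<pi>))"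
  using solves_KZ_mod_I_poly[OF assms(1,2,4-6) _ refl]
    solves_dynamical_mod_I_poly[OF assms(1,2,4-6) _ refl]
  by (auto simp: units_of_subring_def)

end
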